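(* Let $\lambda,P_t,C,D>0$ and $\alpha>0$ be real numbers, and put $z=P_tC$, $x_{2,0}=1$, $x_{2,k}=kD$ for integers $k\ge1$, and $\beta_k=x_{2,k}^{\alpha}$ for $k\ge0$. Let $(\Phi_k)_{k\ge0}$ be independent homogeneous Poisson point processes, each of intensity $\lambda$ on $\{x\in\mathbb{R}:|x|\ge1\}$, whose points $x_i$ carry i.i.d. marks $h_i\sim\exp(1)$ (exponential with mean $1$), independent of all the point processes. Let $$I_{\Phi}=\sum_{k=0}^{\infty}\ \sum_{x_i\in\Phi_k}P_t\,h_i\,l(x_i,x_{2,k}),\qquad l(x_1,x_2)=C\,|x_1|^{-2}x_2^{-\alpha}.$$ Then the Laplace transform of $I_\Phi$ is, for every $s>0$, $$\mathcal{L}_{I_{\Phi(z)}}(s)=\mathbb{E}\left[e^{-sI_\Phi}\right]=\exp\left[-2\lambda\sum_{k=0}^{\infty}\sqrt{\frac{sz}{\beta_k}}\,\arctan\left(\sqrt{\frac{sz}{\beta_k}}\right)\right].$$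
   Context: Interpretation: $\Phi_k$ is the set of positions of transmitting cars along the $k$-th vertical street of a Manhattan street grid, $D$ is the distance between neighbouring streets, $P_t$ is the transmit power, $h_i$ is the Rayleigh fading power gain, $l$ is the path loss, and $I_\Phi$ is the total interference from all vertical streets. The "non-singular path loss model" means that only transmitters at distance $|x_1|\ge 1$ along the street are taken into account. Sums of nonnegative terms take values in $[0,\infty]$, with the convention $e^{-\infty}=0$. *)

theory Defs
  imports "HOL-Probability.Probability"
begin

definition bounded_borel :: "real set set" where
  "bounded_borel = {B \<in> sets borel. bounded B}"

(* A (simple) point process is a random locally finite set of points.  Its law is that of
   the family of counts card (\<Phi> \<omega> \<inter> B), B bounded Borel, i.e. of the following random
   element of the product space of copies of nat indexed by bounded_borel. *)

abbreviation count_space_M :: "(real set \<Rightarrow> nat) measure" where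
  "count_space_M \<equiv> PiM bounded_borel (\<lambda>_. count_space UNIV)"

definition counts :: "('a \<Rightarrow> real set) \<Rightarrow> 'a \<Rightarrow> real set \<Rightarrow> nat" where
  "counts \<Phi> \<omega> = (\<lambda>B\<in>bounded_borel. card (\<Phi> \<omega> \<inter> B))"

(* Homogeneous Poisson point process of intensity \<rho> on E.  The probabilities are written out
   because the library's poisson_pmf is specified only for strictly positive rates, whereas
   B \<inter> E may be a null set. *)

definition homogeneous_poisson_process ::
    "'a measure \<Rightarrow> real \<Rightarrow> real set \<Rightarrow> ('a \<Rightarrow> real set) \<Rightarrow> bool" where
  "homogeneous_poisson_process M \<rho> E \<Phi> \<longleftrightarrow>
     (\<forall>\<omega>\<in>space M. \<Phi> \<omega> \<subseteq> E \<and> (\<forall>B. bounded B \<longrightarrow> finite (\<Phi> \<omega> \<inter> B))) \<and>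
     counts \<Phi> \<in> measurable M count_space_M \<and>
     (\<forall>B\<in>bounded_borel. \<forall>n.
        measure M {\<omega>\<in>space M. card (\<Phi> \<omega> \<inter> B) = n} =
          (\<rho> * measure lborel (B \<inter> E)) ^ n / fact n * exp (- (\<rho> * measure lborel (B \<inter> E)))) \<and>
     (\<forall>\<B>\<subseteq>bounded_borel. finite \<B> \<and> disjoint \<B> \<longrightarrow>
        prob_space.indep_vars M (\<lambda>_. count_space UNIV) (\<lambda>B \<omega>. card (\<Phi> \<omega> \<inter> B)) \<B>)"

definition path_loss :: "real \<Rightarrow> real \<Rightarrow> real \<Rightarrow> real \<Rightarrow> real" where
  "path_loss C \<alpha> x1 x2 = C * \<bar>x1\<bar> powr (-2) * x2 powr (-\<alpha>)"

definition street_dist :: "real \<Rightarrow> nat \<Rightarrow> real" where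
  "street_dist D k = (if k = 0 then 1 else real k * D)"

(* x k i is the i-th point of the k-th street and h k i its mark. *)

definition interference ::
    "real \<Rightarrow> real \<Rightarrow> real \<Rightarrow> real \<Rightarrow> (nat \<Rightarrow> nat \<Rightarrow> 'a \<Rightarrow> real) \<Rightarrow> (nat \<Rightarrow> nat \<Rightarrow> 'a \<Rightarrow> real) \<Rightarrow> 'a \<Rightarrow> ennreal"
  where
  "interference P C \<alpha> D x h \<omega> =
     (\<Sum>k. \<Sum>i. ennreal (P * h k i \<omega> * path_loss C \<alpha> (x k i \<omega>) (street_dist D k)))"

definition exp_neg :: "ennreal \<Rightarrow> real" where
  "exp_neg t = (if t = \<infinity> then 0 else exp (- enn2real t))"

definition laplace_transform :: "'a measure \<Rightarrow> ('a \<Rightarrow> ennreal) \<Rightarrow> real \<Rightarrow> real" where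
  "laplace_transform M I s = integral\<^sup>L M (\<lambda>\<omega>. exp_neg (ennreal s * I \<omega>))"

end

theory Submission
  imports Defs
begin

text \<open>
  Given the points, integrating out the independent exponential marks replaces the factor
  \<open>exp (-w h)\<close> of a point by \<open>1 / (1 + w) = exp (- ln (1 + w))\<close>. What remains is, by
  independence, the product over the streets of the Laplace functionals
  \<open>exp (- \<rho> \<integral> (1 - exp (-f)))\<close> of Poisson processes at \<open>f = ln (1 + w)\<close>. These are computed for step
  functions, where they reduce to the generating functions of independent Poisson counts, and
  extended by monotone limits. With \<open>w u = a / u\<^sup>2\<close> the integral is that of
  \<open>a / (a + u\<^sup>2)\<close> over \<open>|u| \<ge> 1\<close>, which is \<open>2 sqrt a arctan (sqrt a)\<close>.
\<close>

section \<open>The function \<open>exp_neg\<close> on [0, infinity]\<close>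

lemma exp_neg_ennreal: "0 \<le> t \<Longrightarrow> exp_neg (ennreal t) = exp (- t)"
  by (simp add: exp_neg_def)

lemma exp_neg_0 [simp]: "exp_neg 0 = 1"
  by (simp add: exp_neg_def)

lemma exp_neg_nonneg [simp]: "0 \<le> exp_neg t"
  by (simp add: exp_neg_def)

lemma exp_neg_le_1 [simp]: "exp_neg t \<le> 1"
  by (simp add: exp_neg_def)

text \<open>The value 0 at infinity keeps the exponential law valid for infinite arguments, so
  divergent sums need no separate treatment later.\<close>

lemma exp_neg_add: "exp_neg (a + b) = exp_neg a * exp_neg b"
  by (cases a; cases b) (auto simp: exp_neg_def exp_add[symmetric] enn2real_plus)

lemma exp_neg_sum: "exp_neg (\<Sum>i\<in>I. f i) = (\<Prod>i\<in>I. exp_neg (f i))"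
  by (induction I rule: infinite_finite_induct) (auto simp: exp_neg_add)

lemma exp_neg_antimono: "a \<le> b \<Longrightarrow> exp_neg b \<le> exp_neg a"
  using exp_neg_add[of a "b - a"] mult_left_le[of "exp_neg (b - a)" "exp_neg a"]
  by (simp add: add_diff_inverse_ennreal)

lemma borel_measurable_exp_neg [measurable]: "exp_neg \<in> borel_measurable borel"
  unfolding exp_neg_def by measurable

text \<open>Continuity holds on all of [0, infinity], the point infinity included, because the value
  there is the limit 0 of the exponential. All later limit passages use it: partial sums, step
  functions, and integrals that may be infinite.\<close>

lemma tendsto_exp_neg:
  assumes "(f \<longlongrightarrow> L) F"
  shows "((\<lambda>x. exp_neg (f x)) \<longlongrightarrow> exp_neg L) F"
proof (cases L rule: ennreal_cases)
  case (real r)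
  have "((\<lambda>x. exp (- enn2real (f x))) \<longlongrightarrow> exp (- r)) F"
    using assms real by (intro tendsto_intros) auto
  moreover have "eventually (\<lambda>x. f x < top) F"
    using assms real by (auto simp: order_tendsto_iff)
  then have "eventually (\<lambda>x. exp (- enn2real (f x)) = exp_neg (f x)) F"
    by eventually_elim (auto simp: exp_neg_def)
  ultimately show ?thesis
    using real by (simp add: exp_neg_ennreal tendsto_cong)
next
  case top
  have "eventually (\<lambda>x. exp_neg (f x) < e) F" if "e > 0" for e
  proof -
    \<comment> \<open>From the level \<open>l\<close> on, \<open>exp_neg\<close> is at most exp (ln
      \<open>e\<close> - 1), a fixed factor below \<open>e\<close>. The maximum with 0 keeps
      \<open>ennreal l\<close> from truncating a negative number.\<close>
    define l where "l = max 0 (1 - ln e)"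
    have "exp (- l) \<le> exp (ln e - 1)" by (simp add: l_def)
    also have "\<dots> < exp (ln e)" by (simp only: exp_less_mono)
    finally have "exp (- l) < e" using that by simp
    moreover have "0 \<le> l" by (simp add: l_def)
    ultimately have "exp_neg t < e" if "ennreal l < t" for t
      using exp_neg_antimono[OF less_imp_le[OF that]] by (simp add: exp_neg_ennreal)
    then show ?thesis
      using assms top \<open>0 \<le> l\<close>
      by (auto simp: tendsto_top_iff_ennreal elim!: allE[of _ l] eventually_mono)
  qed
  moreover have "exp_neg L = 0"
    using top by (simp add: exp_neg_def)
  ultimately show ?thesis
    using less_le_trans[OF _ exp_neg_nonneg] by (intro order_tendstoI) (auto intro: always_eventually)
qed

section \<open>Two explicit integrals: one exponential mark, and the integral over a street\<close>

lemma nn_integral_exp_neg_exponential: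
  assumes "distributed M lborel H (exponential_density 1)" "0 \<le> c"
  shows "(\<integral>\<^sup>+\<omega>. ennreal (exp_neg (ennreal (c * H \<omega>))) \<partial>M) = ennreal (1 / (1 + c))"
proof -
  have "(\<integral>\<^sup>+\<omega>. ennreal (exp_neg (ennreal (c * H \<omega>))) \<partial>M)
      = (\<integral>\<^sup>+t. ennreal (exponential_density 1 t) * ennreal (exp_neg (ennreal (c * t))) \<partial>lborel)"
    by (rule distributed_nn_integral[OF assms(1), symmetric]) measurable
  \<comment> \<open>Tilting the rate 1 density by exp (-c t) gives the density of rate 1 + c up to
    the factor 1 / (1 + c), and that density has mass one.\<close>
  also have "\<dots> = (\<integral>\<^sup>+t. ennreal (1 / (1 + c)) * ennreal (exponential_density (1 + c) t) \<partial>lborel)"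
    using assms(2)
    by (intro nn_integral_cong)
      (auto simp: exponential_density_def exp_neg_ennreal ennreal_mult[symmetric] exp_add[symmetric]
        field_simps simp del: ennreal_1 intro!: arg_cong[where f=ennreal])
  also have "\<dots> = ennreal (1 / (1 + c)) * (\<integral>\<^sup>+t. ennreal (exponential_density (1 + c) t) \<partial>lborel)"
    by (rule nn_integral_cmult) measurable
  also have "(\<integral>\<^sup>+t. ennreal (exponential_density (1 + c) t) \<partial>lborel) = 1"
  proof -
    interpret prob_space "density lborel (exponential_density (1 + c))"
      using assms(2) by (intro prob_space_exponential_density) simp
    show ?thesis
      using emeasure_space_1 by (simp add: emeasure_density)
  qed
  finally show ?thesis by simp
qed

text \<open>On the right half the antiderivative sqrt a * arctan (u / sqrt a) leaves sqrt a * (pi/2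
  - arctan (1 / sqrt a)), and the reciprocal rule for arctan turns this into sqrt a * arctan (sqrt
  a). The left half contributes the same by symmetry.\<close>

lemma nn_integral_rational_outside_unit_interval:
  assumes "0 < a"
  shows "(\<integral>\<^sup>+u. ennreal (a / (a + u\<^sup>2)) * indicator {u. \<bar>u\<bar> \<ge> 1} u \<partial>lborel)
    = 2 * ennreal (sqrt a * arctan (sqrt a))"
proof -
  let ?f = "\<lambda>u::real. a / (a + u\<^sup>2)"
  define F where "F u = sqrt a * arctan (u / sqrt a)" for u
  have half: "(\<integral>\<^sup>+u. ennreal (?f u) * indicator {1..} u \<partial>lborel) = ennreal (sqrt a * arctan (sqrt a))"
  proof -
    have "(\<integral>\<^sup>+u. ennreal (?f u) * indicator {1..} u \<partial>lborel) = ennreal (sqrt a * (pi / 2) - F 1)"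
    proof (rule nn_integral_FTC_atLeast)
      show "?f \<in> borel_measurable borel" by measurable
      show "DERIV F u :> ?f u" for u
        unfolding F_def using assms
        by (auto intro!: derivative_eq_intros simp: field_simps real_sqrt_pow2)
      show "0 \<le> ?f u" for u using assms by (simp add: add_nonneg_nonneg)
      have "filterlim (\<lambda>u. u / sqrt a) at_top at_top"
        using assms filterlim_tendsto_pos_mult_at_top[OF tendsto_const, of "1 / sqrt a" "\<lambda>u. u"]
        by (simp add: filterlim_ident)
      then show "(F \<longlongrightarrow> sqrt a * (pi / 2)) at_top"
        unfolding F_def
        by (intro tendsto_intros filterlim_compose[OF tendsto_arctan_at_top])
    qed
    also have "sqrt a * (pi / 2) - F 1 = sqrt a * arctan (sqrt a)"
      using assms arctan_inverse[of "sqrt a"]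
      by (simp add: F_def inverse_eq_divide right_diff_distrib)
    finally show ?thesis .
  qed
  \<comment> \<open>The two half-lines are disjoint, and \<open>?f\<close> is even, so the
    reflection u -> -u has to appear in the indicator only.\<close>
  have "(\<integral>\<^sup>+u. ennreal (?f u) * indicator {u. \<bar>u\<bar> \<ge> 1} u \<partial>lborel)
      = (\<integral>\<^sup>+u. ennreal (?f u) * indicator {1..} u + ennreal (?f u) * indicator {1..} (- u) \<partial>lborel)"
    by (intro nn_integral_cong) (auto simp: indicator_def)
  also have "\<dots> = (\<integral>\<^sup>+u. ennreal (?f u) * indicator {1..} u \<partial>lborel)
      + (\<integral>\<^sup>+u. ennreal (?f u) * indicator {1..} (- u) \<partial>lborel)"
    by (rule nn_integral_add) measurable
  also have "(\<integral>\<^sup>+u. ennreal (?f u) * indicator {1..} (- u) \<partial>lborel)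
      = (\<integral>\<^sup>+u. ennreal (?f u) * indicator {1..} u \<partial>lborel)"
    using nn_integral_real_affine[of "\<lambda>u. ennreal (?f u) * indicator {1..} u" "-1" 0] by simp
  finally show ?thesis by (simp add: half mult_2)
qed

section \<open>Generating functions of Poisson counts\<close>

lemma exp_neg_mult_of_nat: "exp_neg (t * of_nat n) = exp_neg t ^ n"
  by (induction n) (simp_all add: distrib_left exp_neg_add)

text \<open>Splitting by the value of \<open>N\<close> leaves the exponential series of q \<mu>.
  Both boundary cases occur later: \<mu> = 0 for sets that meet the street in a null set, and q = 0
  for an infinite coefficient; with 0 ^ 0 = 1 the same series covers them.\<close>

lemma (in prob_space) poisson_generating_function:
  fixes N :: "'a \<Rightarrow> nat"
  assumes [measurable]: "random_variable (count_space UNIV) N"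
    and N: "\<And>n. prob {\<omega>\<in>space M. N \<omega> = n} = \<mu> ^ n / fact n * exp (- \<mu>)"
    and "0 \<le> \<mu>" "0 \<le> q" "q \<le> 1"
  shows "expectation (\<lambda>\<omega>. q ^ N \<omega>) = exp (- (\<mu> * (1 - q)))"
proof -
  have "(\<integral>\<^sup>+\<omega>. ennreal (q ^ N \<omega>) \<partial>M)
      = (\<integral>\<^sup>+\<omega>. (\<Sum>n. ennreal (q ^ n) * indicator {\<omega>\<in>space M. N \<omega> = n} \<omega>) \<partial>M)"
  proof (intro nn_integral_cong)
    fix \<omega> assume "\<omega> \<in> space M"
    then show "ennreal (q ^ N \<omega>) = (\<Sum>n. ennreal (q ^ n) * indicator {\<omega>\<in>space M. N \<omega> = n} \<omega>)"
      by (subst suminf_finite[of "{N \<omega>}"]) auto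
  qed
  also have "\<dots> = (\<Sum>n. ennreal (q ^ n) * emeasure M {\<omega>\<in>space M. N \<omega> = n})"
    by (simp add: nn_integral_suminf nn_integral_cmult_indicator)
  also have "\<dots> = (\<Sum>n. ennreal (exp (- \<mu>) * ((q * \<mu>) ^ n /\<^sub>R fact n)))"
    using assms(3,4)
    by (intro suminf_cong)
      (simp add: emeasure_eq_measure N ennreal_mult[symmetric] power_mult_distrib field_simps)
  also have "\<dots> = ennreal (exp (- \<mu>) * exp (q * \<mu>))"
    using assms(3,4)
    by (intro suminf_ennreal_eq sums_mult exp_converges) (auto intro!: mult_nonneg_nonneg)
  finally have "expectation (\<lambda>\<omega>. q ^ N \<omega>) = exp (- \<mu>) * exp (q * \<mu>)"
    using assms(4) by (subst integral_eq_nn_integral) auto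
  then show ?thesis
    by (simp add: exp_add[symmetric] algebra_simps)
qed

section \<open>Approximation by step functions over disjoint bounded Borel sets\<close>

lemma step_function_representation:
  assumes g: "simple_function borel g" and bdd: "bounded {u. g u \<noteq> 0}"
  obtains \<B> :: "real set set" and c :: "real set \<Rightarrow> ennreal"
  where "\<B> \<subseteq> bounded_borel" "finite \<B>" "disjoint \<B>"
    "\<And>u. g u = (\<Sum>B\<in>\<B>. c B * indicator B u)"
proof
  define R where "R = range g - {0}"
  define \<B> where "\<B> = (\<lambda>y. g -` {y}) ` R"
  \<comment> \<open>The sets are the level sets of the nonzero values. Each is nonempty and
    \<open>g\<close> is constant on it, so the coefficient can be read off the set itself.\<close>
  define c where "c B = the_elem (g ` B)" for B
  have fin: "finite R"
    using simple_functionD(1)[OF g] by (simp add: R_def)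
  have "inj_on (\<lambda>y. g -` {y}) R"
    by (force simp: inj_on_def R_def)
  have c: "c (g -` {y}) = y" if "y \<in> R" for y
  proof -
    have "g ` (g -` {y}) = {y}"
      using that by (auto simp: R_def)
    then show ?thesis by (simp add: c_def)
  qed
  show "\<B> \<subseteq> bounded_borel"
    using simple_functionD(2)[OF g]
    by (auto simp: \<B>_def R_def bounded_borel_def intro!: bounded_subset[OF bdd])
  show "finite \<B>" using fin by (simp add: \<B>_def)
  show "disjoint \<B>" by (auto simp: \<B>_def disjoint_def)
  show "g u = (\<Sum>B\<in>\<B>. c B * indicator B u)" for u
  proof -
    have "(\<Sum>B\<in>\<B>. c B * indicator B u) = (\<Sum>y\<in>R. c (g -` {y}) * indicator (g -` {y}) u)"
      unfolding \<B>_def using \<open>inj_on _ R\<close> by (simp add: sum.reindex)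
    also have "\<dots> = (\<Sum>y\<in>R. if y = g u then y else 0)"
      by (intro sum.cong) (auto simp: c indicator_def)
    also have "\<dots> = g u"
      using fin by (auto simp: R_def)
    finally show ?thesis by simp
  qed
qed

text \<open>Increasing simple functions are cut off to the intervals [-n, n] to make their supports
  bounded. The growing intervals preserve monotonicity, and at a fixed point u the cut-off has no
  effect once n is at least |u|.\<close>

lemma step_function_approximation:
  fixes f :: "real \<Rightarrow> ennreal"
  assumes "f \<in> borel_measurable borel"
  obtains \<B> :: "nat \<Rightarrow> real set set" and c :: "nat \<Rightarrow> real set \<Rightarrow> ennreal"
  where "\<And>n. \<B> n \<subseteq> bounded_borel" "\<And>n. finite (\<B> n)" "\<And>n. disjoint (\<B> n)"
    "incseq (\<lambda>n u. \<Sum>B\<in>\<B> n. c n B * indicator B u)"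
    "\<And>u. (\<lambda>n. \<Sum>B\<in>\<B> n. c n B * indicator B u) \<longlonglongrightarrow> f u"
proof -
  obtain F where F: "\<And>n. simple_function borel (F n)" "incseq F" "\<And>u. (SUP n. F n u) = f u"
    using borel_measurable_implies_simple_function_sequence'[OF assms] by metis
  define g where "g n u = F n u * indicator {-real n..real n} u" for n u
  have "simple_function borel (g n)" for n
    unfolding g_def[abs_def] using F(1) by auto
  moreover have "bounded {u. g n u \<noteq> 0}" for n
    by (rule bounded_subset[of "{-real n..real n}"]) (auto simp: g_def indicator_def)
  ultimately have "\<exists>\<B> c. \<B> \<subseteq> bounded_borel \<and> finite \<B> \<and> disjoint \<B> \<and>
      (\<forall>u. g n u = (\<Sum>B\<in>\<B>. c B * indicator B u))" for n
    by (metis step_function_representation)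
  then obtain \<B> c where Bc: "\<And>n. \<B> n \<subseteq> bounded_borel" "\<And>n. finite (\<B> n)" "\<And>n. disjoint (\<B> n)"
      "\<And>n u. g n u = (\<Sum>B\<in>\<B> n. c n B * indicator B u)"
    by metis
  have "incseq g"
    using F(2) by (auto simp: incseq_def le_fun_def g_def indicator_def)
  have "(\<lambda>n. g n u) \<longlonglongrightarrow> f u" for u
  proof -
    have "incseq (\<lambda>n. F n u)"
      using F(2) by (auto simp: incseq_def le_fun_def)
    then have "(\<lambda>n. F n u) \<longlonglongrightarrow> f u"
      using LIMSEQ_SUP[of "\<lambda>n. F n u"] F(3) by simp
    moreover have "eventually (\<lambda>n. F n u = g n u) sequentially"
      using eventually_ge_at_top[of "nat \<lceil>\<bar>u\<bar>\<rceil>"]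
    proof eventually_elim
      case (elim n)
      then have "\<bar>u\<bar> \<le> real n" by linarith
      then show ?case by (auto simp: g_def indicator_def)
    qed
    ultimately show ?thesis
      by (simp add: tendsto_cong)
  qed
  moreover have "g = (\<lambda>n u. \<Sum>B\<in>\<B> n. c n B * indicator B u)"
    by (intro ext Bc(4))
  ultimately show thesis
    using that[of \<B> c] \<open>incseq g\<close> Bc(1-3) by simp
qed

section \<open>Sums over a locally finite set of points as functions of its counts\<close>

lemma nn_integral_count_space_step:
  assumes "\<B> \<subseteq> bounded_borel" and "\<And>B. bounded B \<Longrightarrow> finite (A \<inter> B)"
  shows "(\<integral>\<^sup>+u. (\<Sum>B\<in>\<B>. c B * indicator B u) \<partial>count_space A) = (\<Sum>B\<in>\<B>. c B * of_nat (card (A \<inter> B)))"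
proof -
  have "(\<integral>\<^sup>+u. (\<Sum>B\<in>\<B>. c B * indicator B u) \<partial>count_space A)
      = (\<Sum>B\<in>\<B>. \<integral>\<^sup>+u. c B * indicator B u \<partial>count_space A)"
    by (rule nn_integral_sum) simp
  also have "\<dots> = (\<Sum>B\<in>\<B>. c B * of_nat (card (A \<inter> B)))"
  proof (intro sum.cong refl)
    fix B assume "B \<in> \<B>"
    then have "finite (A \<inter> B)"
      using assms by (auto simp: bounded_borel_def)
    then show "(\<integral>\<^sup>+u. c B * indicator B u \<partial>count_space A) = c B * of_nat (card (A \<inter> B))"
      by (simp add: nn_integral_cmult nn_integral_indicator' Int_commute)
  qed
  finally show ?thesis .
qed

text \<open>Independence of the streets is a statement about their counts, so sums over points must
  be expressed through counts. For step functions this is a finite combination of coordinates;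
  monotone convergence gives the general case as a countable supremum, hence a measurable
  \<open>G\<close>, chosen before the point set \<open>A\<close> is known.\<close>

lemma nn_integral_count_space_counts:
  fixes f :: "real \<Rightarrow> ennreal"
  assumes f: "f \<in> borel_measurable borel"
  obtains G where "G \<in> borel_measurable count_space_M"
    "\<And>(A :: 'b \<Rightarrow> real set) \<omega>. (\<And>B. bounded B \<Longrightarrow> finite (A \<omega> \<inter> B)) \<Longrightarrow>
      (\<integral>\<^sup>+u. f u \<partial>count_space (A \<omega>)) = G (counts A \<omega>)"
proof -
  obtain \<B> c where Bc: "\<And>n. \<B> n \<subseteq> bounded_borel" "\<And>n. finite (\<B> n)" "\<And>n. disjoint (\<B> n)"
    "incseq (\<lambda>n u. \<Sum>B\<in>\<B> n. c n B * indicator B u)"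
    "\<And>u. (\<lambda>n. \<Sum>B\<in>\<B> n. c n B * indicator B u) \<longlonglongrightarrow> f u"
    by (rule step_function_approximation[OF f]) (rule that; assumption)
  define G where "G N = (SUP n. \<Sum>B\<in>\<B> n. c n B * of_nat (N B))" for N :: "real set \<Rightarrow> nat"
  show thesis
  proof
    show "G \<in> borel_measurable count_space_M"
      unfolding G_def[abs_def]
    proof (intro borel_measurable_SUP borel_measurable_sum)
      show "(\<lambda>N. c n B * of_nat (N B)) \<in> borel_measurable count_space_M" if "B \<in> \<B> n" for n B
        by (rule measurable_compose[OF measurable_component_singleton]) (use that Bc(1) in auto)
    qed simp
    fix A :: "'b \<Rightarrow> real set" and \<omega>
    assume A: "\<And>B. bounded B \<Longrightarrow> finite (A \<omega> \<inter> B)"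
    have "(\<integral>\<^sup>+u. f u \<partial>count_space (A \<omega>))
        = (\<integral>\<^sup>+u. (SUP n. \<Sum>B\<in>\<B> n. c n B * indicator B u) \<partial>count_space (A \<omega>))"
    proof (intro nn_integral_cong)
      fix u
      have "incseq (\<lambda>n. \<Sum>B\<in>\<B> n. c n B * indicator B u)"
        using Bc(4) by (simp add: incseq_def le_fun_def)
      then show "f u = (SUP n. \<Sum>B\<in>\<B> n. c n B * indicator B u)"
        using LIMSEQ_SUP LIMSEQ_unique Bc(5) by blast
    qed
    also have "\<dots> = (SUP n. \<integral>\<^sup>+u. (\<Sum>B\<in>\<B> n. c n B * indicator B u) \<partial>count_space (A \<omega>))"
      by (rule nn_integral_monotone_convergence_SUP[OF Bc(4)]) simp
    also have "\<dots> = (SUP n. \<Sum>B\<in>\<B> n. c n B * of_nat (card (A \<omega> \<inter> B)))"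
      by (simp add: nn_integral_count_space_step[OF Bc(1) A])
    also have "\<dots> = G (counts A \<omega>)"
      unfolding G_def counts_def using Bc(1) by (intro SUP_cong refl sum.cong) auto
    finally show "(\<integral>\<^sup>+u. f u \<partial>count_space (A \<omega>)) = G (counts A \<omega>)" .
  qed
qed

section \<open>The Laplace functional of a Poisson process\<close>

context prob_space
begin

context
  fixes \<rho> :: real and E :: "real set" and \<Phi> :: "'a \<Rightarrow> real set"
  assumes \<rho>: "0 \<le> \<rho>" and E [measurable]: "E \<in> sets borel"
    and poisson: "homogeneous_poisson_process M \<rho> E \<Phi>"
begin

lemma poisson_process_locally_finite:
  "\<omega> \<in> space M \<Longrightarrow> bounded B \<Longrightarrow> finite (\<Phi> \<omega> \<inter> B)"
  using poisson unfolding homogeneous_poisson_process_def by blast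

lemma poisson_process_measurable_card:
  assumes "B \<in> bounded_borel"
  shows "(\<lambda>\<omega>. card (\<Phi> \<omega> \<inter> B)) \<in> measurable M (count_space UNIV)"
proof -
  have "(\<lambda>\<omega>. counts \<Phi> \<omega> B) \<in> measurable M (count_space UNIV)"
    by (rule measurable_compose[OF _ measurable_component_singleton[OF assms]])
      (use poisson in \<open>unfold homogeneous_poisson_process_def, blast\<close>)
  then show ?thesis
    using assms by (simp add: counts_def)
qed

text \<open>Counts of disjoint sets are independent, so the expectation factors into generating
  functions at q = \<open>exp_neg (c B)\<close>. The exponents add up to the integral of 1 - exp
  (-g) for the step function g, since by disjointness a point sees at most one coefficient.\<close>

lemma laplace_functional_step:
  fixes c :: "real set \<Rightarrow> ennreal"
  assumes B: "\<B> \<subseteq> bounded_borel" and [simp]: "finite \<B>" and "disjoint \<B>"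
  shows "expectation (\<lambda>\<omega>. exp_neg (\<Sum>B\<in>\<B>. c B * of_nat (card (\<Phi> \<omega> \<inter> B)))) =
    exp_neg (ennreal \<rho> * (\<integral>\<^sup>+u\<in>E. ennreal (1 - exp_neg (\<Sum>B\<in>\<B>. c B * indicator B u)) \<partial>lborel))"
proof -
  define \<mu> where "\<mu> B = \<rho> * measure lborel (B \<inter> E)" for B
  have mu: "0 \<le> \<mu> B" for B
    using \<rho> by (simp add: \<mu>_def)
  have ind: "indep_vars (\<lambda>_. count_space UNIV) (\<lambda>B \<omega>. card (\<Phi> \<omega> \<inter> B)) \<B>"
    using poisson assms unfolding homogeneous_poisson_process_def by blast
  have "expectation (\<lambda>\<omega>. exp_neg (\<Sum>B\<in>\<B>. c B * of_nat (card (\<Phi> \<omega> \<inter> B))))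
      = expectation (\<lambda>\<omega>. \<Prod>B\<in>\<B>. exp_neg (c B) ^ card (\<Phi> \<omega> \<inter> B))"
    by (simp add: exp_neg_sum exp_neg_mult_of_nat)
  also have "\<dots> = (\<Prod>B\<in>\<B>. expectation (\<lambda>\<omega>. exp_neg (c B) ^ card (\<Phi> \<omega> \<inter> B)))"
  proof (rule indep_vars_lebesgue_integral)
    show "indep_vars (\<lambda>_. borel) (\<lambda>B \<omega>. exp_neg (c B) ^ card (\<Phi> \<omega> \<inter> B)) \<B>"
      by (rule indep_vars_compose2[OF ind]) simp
    show "integrable M (\<lambda>\<omega>. exp_neg (c B) ^ card (\<Phi> \<omega> \<inter> B))" if "B \<in> \<B>" for B
    proof (rule integrable_const_bound[where B=1])
      show "(\<lambda>\<omega>. exp_neg (c B) ^ card (\<Phi> \<omega> \<inter> B)) \<in> borel_measurable M"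
        by (rule measurable_compose[OF poisson_process_measurable_card]) (use that B in auto)
    qed (auto simp: power_le_one)
  qed simp
  also have "\<dots> = (\<Prod>B\<in>\<B>. exp (- (\<mu> B * (1 - exp_neg (c B)))))"
  proof (intro prod.cong refl poisson_generating_function mu)
    fix B assume "B \<in> \<B>"
    then show "random_variable (count_space UNIV) (\<lambda>\<omega>. card (\<Phi> \<omega> \<inter> B))"
      using B by (intro poisson_process_measurable_card) auto
    show "prob {\<omega>\<in>space M. card (\<Phi> \<omega> \<inter> B) = n} = \<mu> B ^ n / fact n * exp (- \<mu> B)" for n
      using poisson B \<open>B \<in> \<B>\<close> unfolding homogeneous_poisson_process_def \<mu>_def by blast
  qed auto
  also have "\<dots> = exp_neg (ennreal (\<Sum>B\<in>\<B>. \<mu> B * (1 - exp_neg (c B))))"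
    using mu by (simp add: exp_neg_ennreal sum_nonneg exp_sum[symmetric] sum_negf)
  also have "ennreal (\<Sum>B\<in>\<B>. \<mu> B * (1 - exp_neg (c B)))
      = ennreal \<rho> * (\<Sum>B\<in>\<B>. ennreal (1 - exp_neg (c B)) * emeasure lborel (B \<inter> E))"
    unfolding sum_distrib_left
  proof (subst sum_ennreal[symmetric], use mu in simp, intro sum.cong refl)
    fix B assume "B \<in> \<B>"
    \<comment> \<open>A bounded set has finite Lebesgue measure, so the real-valued rate agrees with
      the extended one.\<close>
    then have "bounded (B \<inter> E)" using B by (auto simp: bounded_borel_def intro: bounded_Int)
    then have "emeasure lborel (B \<inter> E) \<noteq> \<infinity>"
      using emeasure_bounded_finite by (simp add: less_top)
    then show "ennreal (\<mu> B * (1 - exp_neg (c B)))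
        = ennreal \<rho> * (ennreal (1 - exp_neg (c B)) * emeasure lborel (B \<inter> E))"
      using \<rho> by (simp add: emeasure_eq_ennreal_measure \<mu>_def ennreal_mult mult_ac)
  qed
  also have "(\<Sum>B\<in>\<B>. ennreal (1 - exp_neg (c B)) * emeasure lborel (B \<inter> E))
      = (\<integral>\<^sup>+u. (\<Sum>B\<in>\<B>. ennreal (1 - exp_neg (c B)) * indicator (B \<inter> E) u) \<partial>lborel)"
  proof (subst nn_integral_sum)
    have "B \<inter> E \<in> sets lborel" if "B \<in> \<B>" for B
      using that B by (auto simp: bounded_borel_def)
    then show "(\<Sum>B\<in>\<B>. ennreal (1 - exp_neg (c B)) * emeasure lborel (B \<inter> E))
        = (\<Sum>B\<in>\<B>. \<integral>\<^sup>+u. ennreal (1 - exp_neg (c B)) * indicator (B \<inter> E) u \<partial>lborel)"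
      by (intro sum.cong refl nn_integral_cmult_indicator[symmetric])
  qed (use B in \<open>auto simp: bounded_borel_def\<close>)
  also have "\<dots> = (\<integral>\<^sup>+u\<in>E. ennreal (1 - exp_neg (\<Sum>B\<in>\<B>. c B * indicator B u)) \<partial>lborel)"
  proof (intro nn_integral_cong)
    fix u
    show "(\<Sum>B\<in>\<B>. ennreal (1 - exp_neg (c B)) * indicator (B \<inter> E) u)
        = ennreal (1 - exp_neg (\<Sum>B\<in>\<B>. c B * indicator B u)) * indicator E u"
    \<comment> \<open>Inside the union one set \<open>B0\<close> is selected, and
      \<open>pick\<close> applies both to the outer sum and to the sum within
      \<open>exp_neg\<close>. Outside it both sides vanish, because
      \<open>exp_neg 0 = 1\<close>.\<close>
    proof (cases "\<exists>B\<in>\<B>. u \<in> B")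
      case True
      then obtain B0 where "B0 \<in> \<B>" "u \<in> B0" by auto
      then have ind: "indicator B u = (if B = B0 then 1 else 0 :: ennreal)" if "B \<in> \<B>" for B
        using that \<open>disjoint \<B>\<close> by (auto simp: disjoint_def indicator_def)
      have pick: "(\<Sum>B\<in>\<B>. \<phi> B * indicator B u) = \<phi> B0" for \<phi> :: "real set \<Rightarrow> ennreal"
      proof -
        have "(\<Sum>B\<in>\<B>. \<phi> B * indicator B u) = (\<Sum>B\<in>\<B>. if B = B0 then \<phi> B else 0)"
          by (intro sum.cong refl) (simp add: ind)
        also have "\<dots> = \<phi> B0"
          using \<open>B0 \<in> \<B>\<close> by (subst sum.delta) auto
        finally show ?thesis .
      qed
      have "(\<Sum>B\<in>\<B>. ennreal (1 - exp_neg (c B)) * indicator (B \<inter> E) u)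
          = (\<Sum>B\<in>\<B>. ennreal (1 - exp_neg (c B)) * indicator E u * indicator B u)"
        by (intro sum.cong refl) (simp add: indicator_inter_arith mult_ac)
      then show ?thesis by (simp only: pick)
    next
      case False
      then show ?thesis by (auto simp: indicator_def)
    qed
  qed
  finally show ?thesis .
qed

end

text \<open>Step functions increase to f. The left side converges by dominated convergence with
  bound 1; on the right the integrands 1 - exp (-g) increase, so monotone convergence
  applies.\<close>

lemma laplace_functional_poisson:
  fixes f :: "real \<Rightarrow> ennreal"
  assumes "0 \<le> \<rho>" and E [measurable]: "E \<in> sets borel"
    and poisson: "homogeneous_poisson_process M \<rho> E \<Phi>"
    and f: "f \<in> borel_measurable borel"
  shows "expectation (\<lambda>\<omega>. exp_neg (\<integral>\<^sup>+u. f u \<partial>count_space (\<Phi> \<omega>))) =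
    exp_neg (ennreal \<rho> * (\<integral>\<^sup>+u\<in>E. ennreal (1 - exp_neg (f u)) \<partial>lborel))"
proof -
  note P = assms(1-3)
  obtain \<B> c where Bc: "\<And>n. \<B> n \<subseteq> bounded_borel" "\<And>n. finite (\<B> n)" "\<And>n. disjoint (\<B> n)"
    "incseq (\<lambda>n u. \<Sum>B\<in>\<B> n. c n B * indicator B u)"
    "\<And>u. (\<lambda>n. \<Sum>B\<in>\<B> n. c n B * indicator B u) \<longlonglongrightarrow> f u"
    by (rule step_function_approximation[OF f]) (rule that; assumption)
  define g where "g n u = (\<Sum>B\<in>\<B> n. c n B * indicator B u)" for n u
  have g: "incseq g" "\<And>u. (\<lambda>n. g n u) \<longlonglongrightarrow> f u"
    using Bc(4,5) by (simp_all add: g_def[abs_def])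
  have [measurable]: "g n \<in> borel_measurable borel" for n
    unfolding g_def[abs_def] using Bc(1)[of n]
    by (intro borel_measurable_sum borel_measurable_times_ennreal) (auto simp: bounded_borel_def)
  \<comment> \<open>On the sample space this is the sum of \<open>g n\<close> over the points;
    written through counts it is visibly a random variable. Measurability of the limit functional is
    then inherited from the sequence.\<close>
  define Z where "Z n \<omega> = (\<Sum>B\<in>\<B> n. c n B * of_nat (card (\<Phi> \<omega> \<inter> B)))" for n \<omega>
  have Z: "Z n \<omega> = (\<integral>\<^sup>+u. g n u \<partial>count_space (\<Phi> \<omega>))" if "\<omega> \<in> space M" for n \<omega>
    unfolding Z_def g_def
    by (rule nn_integral_count_space_step[OF Bc(1), symmetric])
      (use poisson_process_locally_finite[OF P] that in auto)
  have [measurable]: "Z n \<in> borel_measurable M" for n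
  proof -
    have "(\<lambda>\<omega>. c n B * of_nat (card (\<Phi> \<omega> \<inter> B))) \<in> borel_measurable M" if "B \<in> \<B> n" for B
      by (rule measurable_compose[OF poisson_process_measurable_card[OF P]]) (use that Bc(1) in auto)
    then show ?thesis
      unfolding Z_def[abs_def] by (rule borel_measurable_sum)
  qed
  have lim: "(\<lambda>n. Z n \<omega>) \<longlonglongrightarrow> (\<integral>\<^sup>+u. f u \<partial>count_space (\<Phi> \<omega>))" if "\<omega> \<in> space M" for \<omega>
    using nn_integral_LIMSEQ[OF g(1) _ g(2), of "count_space (\<Phi> \<omega>)"] that by (simp add: Z)
  have "(\<lambda>n. expectation (\<lambda>\<omega>. exp_neg (Z n \<omega>)))
      \<longlonglongrightarrow> expectation (\<lambda>\<omega>. exp_neg (\<integral>\<^sup>+u. f u \<partial>count_space (\<Phi> \<omega>)))"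
  proof (rule integral_dominated_convergence[where w="\<lambda>_. 1"])
    show "(\<lambda>\<omega>. exp_neg (\<integral>\<^sup>+u. f u \<partial>count_space (\<Phi> \<omega>))) \<in> borel_measurable M"
      by (rule borel_measurable_LIMSEQ_real[of _ "\<lambda>n \<omega>. exp_neg (Z n \<omega>)"])
        (auto intro!: tendsto_exp_neg lim)
  qed (auto intro!: tendsto_exp_neg lim)
  moreover have "(\<lambda>n. exp_neg (ennreal \<rho> * (\<integral>\<^sup>+u\<in>E. ennreal (1 - exp_neg (g n u)) \<partial>lborel)))
      \<longlonglongrightarrow> exp_neg (ennreal \<rho> * (\<integral>\<^sup>+u\<in>E. ennreal (1 - exp_neg (f u)) \<partial>lborel))"
  proof (intro tendsto_exp_neg ennreal_tendsto_cmult nn_integral_LIMSEQ)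
    show "incseq (\<lambda>n u. ennreal (1 - exp_neg (g n u)) * indicator E u)"
      using g(1) by (auto simp: incseq_def le_fun_def intro!: mult_right_mono ennreal_leI exp_neg_antimono)
    show "(\<lambda>n. ennreal (1 - exp_neg (g n u)) * indicator E u)
        \<longlonglongrightarrow> ennreal (1 - exp_neg (f u)) * indicator E u" for u
    proof -
      have "(\<lambda>n. ennreal (1 - exp_neg (g n u))) \<longlonglongrightarrow> ennreal (1 - exp_neg (f u))"
        by (intro tendsto_ennrealI tendsto_diff tendsto_const tendsto_exp_neg g(2))
      then show ?thesis by (cases "u \<in> E") simp_all
    qed
  qed auto
  moreover have "expectation (\<lambda>\<omega>. exp_neg (Z n \<omega>))
      = exp_neg (ennreal \<rho> * (\<integral>\<^sup>+u\<in>E. ennreal (1 - exp_neg (g n u)) \<partial>lborel))" for n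
    unfolding Z_def g_def by (rule laplace_functional_step[OF P Bc(1-3)])
  ultimately show ?thesis
    using LIMSEQ_unique by simp
qed


section \<open>Integrating out the exponential marks\<close>

lemma laplace_exponential_marks_finite:
  fixes H X :: "'i \<Rightarrow> 'a \<Rightarrow> real" and c :: "'i \<Rightarrow> real \<Rightarrow> real"
  assumes J: "finite J"
    and exp: "\<And>j. distributed M lborel (H j) (exponential_density 1)"
    and ind: "indep_vars (\<lambda>_. borel) H UNIV"
    and HX: "indep_var (PiM UNIV (\<lambda>_. borel)) (\<lambda>\<omega> j. H j \<omega>) (PiM UNIV (\<lambda>_. borel)) (\<lambda>\<omega> j. X j \<omega>)"
    and c [measurable]: "\<And>j. c j \<in> borel_measurable borel" and c0: "\<And>j u. 0 \<le> c j u"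
  shows "expectation (\<lambda>\<omega>. exp_neg (\<Sum>j\<in>J. ennreal (c j (X j \<omega>) * H j \<omega>))) =
    expectation (\<lambda>\<omega>. exp_neg (\<Sum>j\<in>J. ennreal (ln (1 + c j (X j \<omega>)))))"
proof -
  let ?P = "PiM UNIV (\<lambda>_. borel) :: ('i \<Rightarrow> real) measure"
  note rv = indep_var_rv1[OF HX] indep_var_rv2[OF HX]
  note [measurable] = rv
  have Hm [measurable]: "H j \<in> borel_measurable M" for j
    using measurable_compose[OF rv(1) measurable_component_singleton[of j]] by simp
  have Xm [measurable]: "X j \<in> borel_measurable M" for j
    using measurable_compose[OF rv(2) measurable_component_singleton[of j]] by simp
  define F where "F p = (\<Prod>j\<in>J. ennreal (exp_neg (ennreal (c j (snd p j) * fst p j))))"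
    for p :: "('i \<Rightarrow> real) \<times> ('i \<Rightarrow> real)"
  have F [measurable]: "F \<in> borel_measurable (?P \<Otimes>\<^sub>M ?P)"
    unfolding F_def[abs_def] by measurable
  interpret H: prob_space "distr M ?P (\<lambda>\<omega> j. H j \<omega>)" by (rule prob_space_distr) fact
  interpret X: prob_space "distr M ?P (\<lambda>\<omega> j. X j \<omega>)" by (rule prob_space_distr) fact
  interpret pair_sigma_finite "distr M ?P (\<lambda>\<omega> j. H j \<omega>)" "distr M ?P (\<lambda>\<omega> j. X j \<omega>)" ..
  \<comment> \<open>With the positions frozen at an arbitrary \<xi>, only the independent marks are
    random, and each factor is the transform of a single exponential variable.\<close>
  have inner: "(\<integral>\<^sup>+\<omega>. F (\<lambda>j. H j \<omega>, \<xi>) \<partial>M) = (\<Prod>j\<in>J. ennreal (1 / (1 + c j (\<xi> j))))" for \<xi>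
  proof -
    have "indep_vars (\<lambda>_. borel) (\<lambda>j \<omega>. ennreal (exp_neg (ennreal (c j (\<xi> j) * H j \<omega>)))) J"
      by (rule indep_vars_compose2[OF indep_vars_subset[OF ind subset_UNIV]]) measurable
    from indep_vars_nn_integral[OF J this]
    show ?thesis
      by (simp add: F_def nn_integral_exp_neg_exponential[OF exp c0])
  qed
  \<comment> \<open>Independence of marks and positions makes their joint law a product, so Tonelli
    allows the marks to be integrated first.\<close>
  have "(\<integral>\<^sup>+\<omega>. F (\<lambda>j. H j \<omega>, \<lambda>j. X j \<omega>) \<partial>M)
      = (\<integral>\<^sup>+p. F p \<partial>distr M (?P \<Otimes>\<^sub>M ?P) (\<lambda>\<omega>. (\<lambda>j. H j \<omega>, \<lambda>j. X j \<omega>)))"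
    by (rule nn_integral_distr[symmetric]) measurable
  also have "\<dots> = (\<integral>\<^sup>+p. F p \<partial>(distr M ?P (\<lambda>\<omega> j. H j \<omega>) \<Otimes>\<^sub>M distr M ?P (\<lambda>\<omega> j. X j \<omega>)))"
    using HX by (simp add: indep_var_distribution_eq)
  also have "\<dots> = (\<integral>\<^sup>+\<xi>. (\<integral>\<^sup>+\<eta>. F (\<eta>, \<xi>) \<partial>distr M ?P (\<lambda>\<omega> j. H j \<omega>)) \<partial>distr M ?P (\<lambda>\<omega> j. X j \<omega>))"
    by (rule nn_integral_snd[symmetric]) measurable
  also have "\<dots> = (\<integral>\<^sup>+\<xi>. (\<Prod>j\<in>J. ennreal (1 / (1 + c j (\<xi> j)))) \<partial>distr M ?P (\<lambda>\<omega> j. X j \<omega>))"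
    by (intro nn_integral_cong) (simp add: nn_integral_distr inner)
  also have "\<dots> = (\<integral>\<^sup>+\<omega>. (\<Prod>j\<in>J. ennreal (1 / (1 + c j (X j \<omega>)))) \<partial>M)"
    by (rule nn_integral_distr) measurable
  finally have eq: "(\<integral>\<^sup>+\<omega>. F (\<lambda>j. H j \<omega>, \<lambda>j. X j \<omega>) \<partial>M)
      = (\<integral>\<^sup>+\<omega>. (\<Prod>j\<in>J. ennreal (1 / (1 + c j (X j \<omega>)))) \<partial>M)" .
  \<comment> \<open>The logarithm is nonnegative as 1 + c is at least 1; it puts the factors back
    into the form of a Laplace functional of the positions alone.\<close>
  have ln: "exp_neg (ennreal (ln (1 + c j u))) = 1 / (1 + c j u)" for j u
    using c0[of j u] by (simp add: exp_neg_ennreal exp_minus inverse_eq_divide)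
  have "expectation (\<lambda>\<omega>. exp_neg (\<Sum>j\<in>J. ennreal (c j (X j \<omega>) * H j \<omega>)))
      = enn2real (\<integral>\<^sup>+\<omega>. F (\<lambda>j. H j \<omega>, \<lambda>j. X j \<omega>) \<partial>M)"
    by (subst integral_eq_nn_integral) (auto simp: F_def exp_neg_sum prod_ennreal intro!: AE_I2 prod_nonneg)
  moreover have "expectation (\<lambda>\<omega>. exp_neg (\<Sum>j\<in>J. ennreal (ln (1 + c j (X j \<omega>)))))
      = enn2real (\<integral>\<^sup>+\<omega>. (\<Prod>j\<in>J. ennreal (1 / (1 + c j (X j \<omega>)))) \<partial>M)"
    unfolding exp_neg_sum ln using c0
    by (subst integral_eq_nn_integral) (auto simp: prod_ennreal intro!: AE_I2 prod_nonneg)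
  ultimately show ?thesis by (simp add: eq)
qed

lemma expectation_exp_neg_suminf:
  fixes T :: "nat \<Rightarrow> 'a \<Rightarrow> ennreal"
  assumes [measurable]: "\<And>n. T n \<in> borel_measurable M"
  shows "(\<lambda>n. expectation (\<lambda>\<omega>. exp_neg (\<Sum>i<n. T i \<omega>))) \<longlonglongrightarrow> expectation (\<lambda>\<omega>. exp_neg (\<Sum>i. T i \<omega>))"
  by (rule integral_dominated_convergence[where w="\<lambda>_. 1"])
    (auto intro!: tendsto_exp_neg summable_LIMSEQ)

text \<open>The injection \<open>e\<close> lists indices without repetition, so the partial sums of
  the series are sums over finite index sets, where the finite case applies. Both expectations are
  thus limits of one sequence.\<close>

lemma laplace_exponential_marks:
  fixes H X :: "'i \<Rightarrow> 'a \<Rightarrow> real" and c :: "'i \<Rightarrow> real \<Rightarrow> real" and e :: "nat \<Rightarrow> 'i"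
  assumes e: "inj e"
    and exp: "\<And>j. distributed M lborel (H j) (exponential_density 1)"
    and ind: "indep_vars (\<lambda>_. borel) H UNIV"
    and HX: "indep_var (PiM UNIV (\<lambda>_. borel)) (\<lambda>\<omega> j. H j \<omega>) (PiM UNIV (\<lambda>_. borel)) (\<lambda>\<omega> j. X j \<omega>)"
    and c [measurable]: "\<And>j. c j \<in> borel_measurable borel" and c0: "\<And>j u. 0 \<le> c j u"
  shows "expectation (\<lambda>\<omega>. exp_neg (\<Sum>n. ennreal (c (e n) (X (e n) \<omega>) * H (e n) \<omega>))) =
    expectation (\<lambda>\<omega>. exp_neg (\<Sum>n. ennreal (ln (1 + c (e n) (X (e n) \<omega>)))))"
proof (rule LIMSEQ_unique)
  have [measurable]: "H j \<in> borel_measurable M" "X j \<in> borel_measurable M" for j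
    using measurable_compose[OF indep_var_rv1[OF HX] measurable_component_singleton[of j]]
      measurable_compose[OF indep_var_rv2[OF HX] measurable_component_singleton[of j]] by simp_all
  let ?a = "\<lambda>n \<omega>. ennreal (c (e n) (X (e n) \<omega>) * H (e n) \<omega>)"
  let ?b = "\<lambda>n \<omega>. ennreal (ln (1 + c (e n) (X (e n) \<omega>)))"
  show "(\<lambda>n. expectation (\<lambda>\<omega>. exp_neg (\<Sum>i<n. ?a i \<omega>))) \<longlonglongrightarrow> expectation (\<lambda>\<omega>. exp_neg (\<Sum>i. ?a i \<omega>))"
    by (rule expectation_exp_neg_suminf) measurable
  have "(\<lambda>n. expectation (\<lambda>\<omega>. exp_neg (\<Sum>i<n. ?b i \<omega>))) \<longlonglongrightarrow> expectation (\<lambda>\<omega>. exp_neg (\<Sum>i. ?b i \<omega>))"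
    by (rule expectation_exp_neg_suminf) measurable
  moreover have "expectation (\<lambda>\<omega>. exp_neg (\<Sum>i<n. ?a i \<omega>)) = expectation (\<lambda>\<omega>. exp_neg (\<Sum>i<n. ?b i \<omega>))" for n
    using laplace_exponential_marks_finite[of "e ` {..<n}", OF _ exp ind HX c c0]
    by (simp add: sum.reindex[OF inj_on_subset[OF e subset_UNIV]])
  ultimately show "(\<lambda>n. expectation (\<lambda>\<omega>. exp_neg (\<Sum>i<n. ?a i \<omega>))) \<longlonglongrightarrow> expectation (\<lambda>\<omega>. exp_neg (\<Sum>i. ?b i \<omega>))"
    by simp
qed

section \<open>Superposition of independent streets\<close>

lemma laplace_functional_independent_poisson:
  fixes f :: "nat \<Rightarrow> real \<Rightarrow> ennreal" and \<Phi> :: "nat \<Rightarrow> 'a \<Rightarrow> real set"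
  assumes \<rho>: "0 \<le> \<rho>" and E: "E \<in> sets borel"
    and poisson: "\<And>k. homogeneous_poisson_process M \<rho> E (\<Phi> k)"
    and ind: "indep_vars (\<lambda>_. count_space_M) (\<lambda>k. counts (\<Phi> k)) UNIV"
    and f: "\<And>k. f k \<in> borel_measurable borel"
  shows "(\<lambda>\<omega>. \<Sum>k. \<integral>\<^sup>+u. f k u \<partial>count_space (\<Phi> k \<omega>)) \<in> borel_measurable M"
    and "expectation (\<lambda>\<omega>. exp_neg (\<Sum>k. \<integral>\<^sup>+u. f k u \<partial>count_space (\<Phi> k \<omega>))) =
      exp_neg (ennreal \<rho> * (\<Sum>k. \<integral>\<^sup>+u\<in>E. ennreal (1 - exp_neg (f k u)) \<partial>lborel))"
proof -
  let ?T = "\<lambda>k \<omega>. \<integral>\<^sup>+u. f k u \<partial>count_space (\<Phi> k \<omega>)"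
  let ?J = "\<lambda>k. \<integral>\<^sup>+u\<in>E. ennreal (1 - exp_neg (f k u)) \<partial>lborel"
  \<comment> \<open>Each street's sum becomes a measurable function of its counts, which is the form
    in which independence can be used.\<close>
  have "\<exists>G. G \<in> borel_measurable count_space_M \<and> (\<forall>\<omega>\<in>space M. ?T k \<omega> = G (counts (\<Phi> k) \<omega>))" for k
  proof (rule nn_integral_count_space_counts[OF f[of k]])
    fix G assume G: "G \<in> borel_measurable count_space_M"
      "\<And>(A :: 'a \<Rightarrow> real set) \<omega>. (\<And>B. bounded B \<Longrightarrow> finite (A \<omega> \<inter> B)) \<Longrightarrow>
        (\<integral>\<^sup>+u. f k u \<partial>count_space (A \<omega>)) = G (counts A \<omega>)"
    then show ?thesis
      using poisson_process_locally_finite[OF \<rho> E poisson[of k]] by blast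
  qed
  then obtain G where G [measurable]: "\<And>k. G k \<in> borel_measurable count_space_M"
    and T: "\<And>k \<omega>. \<omega> \<in> space M \<Longrightarrow> ?T k \<omega> = G k (counts (\<Phi> k) \<omega>)"
    by metis
  have [measurable]: "counts (\<Phi> k) \<in> measurable M count_space_M" for k
    using poisson[of k] unfolding homogeneous_poisson_process_def by blast
  have "(\<lambda>\<omega>. G k (counts (\<Phi> k) \<omega>)) \<in> borel_measurable M" for k
    by measurable
  then have T_meas [measurable]: "?T k \<in> borel_measurable M" for k
    using T by (simp cong: measurable_cong)
  then show "(\<lambda>\<omega>. \<Sum>k. ?T k \<omega>) \<in> borel_measurable M" by measurable
  \<comment> \<open>Finitely many streets factor; letting n tend to infinity on both sides then
    gives the full series.\<close>
  have "expectation (\<lambda>\<omega>. exp_neg (\<Sum>k<n. ?T k \<omega>)) = exp_neg (\<Sum>k<n. ennreal \<rho> * ?J k)" for n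
  proof -
    have "expectation (\<lambda>\<omega>. exp_neg (\<Sum>k<n. ?T k \<omega>))
        = expectation (\<lambda>\<omega>. \<Prod>k<n. exp_neg (G k (counts (\<Phi> k) \<omega>)))"
      by (intro Bochner_Integration.integral_cong) (simp_all add: T exp_neg_sum)
    also have "\<dots> = (\<Prod>k<n. expectation (\<lambda>\<omega>. exp_neg (G k (counts (\<Phi> k) \<omega>))))"
    proof (rule indep_vars_lebesgue_integral)
      show "indep_vars (\<lambda>_. borel) (\<lambda>k \<omega>. exp_neg (G k (counts (\<Phi> k) \<omega>))) {..<n}"
        by (rule indep_vars_compose2[OF indep_vars_subset[OF ind subset_UNIV]]) measurable
      show "integrable M (\<lambda>\<omega>. exp_neg (G k (counts (\<Phi> k) \<omega>)))" for k
        by (rule integrable_const_bound[where B=1]) auto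
    qed simp
    also have "\<dots> = (\<Prod>k<n. exp_neg (ennreal \<rho> * ?J k))"
    proof (intro prod.cong refl)
      fix k
      have "expectation (\<lambda>\<omega>. exp_neg (G k (counts (\<Phi> k) \<omega>))) = expectation (\<lambda>\<omega>. exp_neg (?T k \<omega>))"
        by (intro Bochner_Integration.integral_cong) (simp_all add: T)
      then show "expectation (\<lambda>\<omega>. exp_neg (G k (counts (\<Phi> k) \<omega>))) = exp_neg (ennreal \<rho> * ?J k)"
        using laplace_functional_poisson[OF \<rho> E poisson f] by simp
    qed
    finally show ?thesis by (simp add: exp_neg_sum)
  qed
  moreover have "(\<lambda>n. exp_neg (\<Sum>k<n. ennreal \<rho> * ?J k)) \<longlonglongrightarrow> exp_neg (\<Sum>k. ennreal \<rho> * ?J k)"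
    by (intro tendsto_exp_neg summable_LIMSEQ) simp
  moreover note expectation_exp_neg_suminf[of ?T, OF T_meas]
  ultimately show "expectation (\<lambda>\<omega>. exp_neg (\<Sum>k. ?T k \<omega>)) = exp_neg (ennreal \<rho> * (\<Sum>k. ?J k))"
    by (simp add: LIMSEQ_unique)
qed

end

section \<open>The interference on the street grid\<close>

lemma street_dist_pos: "0 < D \<Longrightarrow> 0 < street_dist D k"
  by (simp add: street_dist_def)

theorem proposition4:
  fixes M :: "'a measure"
    and \<rho> P\<^sub>t C D \<alpha> z s :: real
    and \<beta> :: "nat \<Rightarrow> real"
    and \<Phi> :: "nat \<Rightarrow> 'a \<Rightarrow> real set"
    and x h :: "nat \<Rightarrow> nat \<Rightarrow> 'a \<Rightarrow> real"
  assumes "prob_space M"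
    and "\<rho> > 0" "P\<^sub>t > 0" "C > 0" "D > 0" "\<alpha> > 0"
    and z: "z = P\<^sub>t * C"
    and \<beta>: "\<And>k. \<beta> k = street_dist D k powr \<alpha>"
    and poisson: "\<And>k. homogeneous_poisson_process M \<rho> {u. \<bar>u\<bar> \<ge> 1} (\<Phi> k)"
    and indep_processes: "prob_space.indep_vars M (\<lambda>_. count_space_M) (\<lambda>k. counts (\<Phi> k)) UNIV"
    and points: "AE \<omega> in M. \<forall>k. bij_betw (\<lambda>i. x k i \<omega>) UNIV (\<Phi> k \<omega>)"
    and marks_exp: "\<And>k i. distributed M lborel (h k i) (exponential_density 1)"
    and marks_indep: "prob_space.indep_vars M (\<lambda>_. borel) (\<lambda>(k, i). h k i) UNIV"
    and marks_indep_points: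
      "prob_space.indep_var M
         (PiM UNIV (\<lambda>_. borel)) (\<lambda>\<omega> (k, i). h k i \<omega>)
         (PiM UNIV (\<lambda>_. borel)) (\<lambda>\<omega> (k, i). x k i \<omega>)"
    and "s > 0"
  shows "laplace_transform M (interference P\<^sub>t C \<alpha> D x h) s =
    exp_neg (ennreal (2 * \<rho>) *
      (\<Sum>k. ennreal (sqrt (s * z / \<beta> k) * arctan (sqrt (s * z / \<beta> k)))))"
proof -
  interpret prob_space M by fact
  \<comment> \<open>A transmitter at u on street k with mark h contributes the exponent w h, and f
    is chosen so that exp (-f) = 1 / (1 + w). The number \<open>a k\<close> is the square of the
    argument of arctan.\<close>
  define a where "a k = s * z / \<beta> k" for k
  define w where "w k u = s * (P\<^sub>t * path_loss C \<alpha> u (street_dist D k))" for k u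
  define f where "f k u = ennreal (ln (1 + w k u))" for k u
  let ?E = "{u::real. \<bar>u\<bar> \<ge> 1}"
  have \<beta>_pos: "0 < \<beta> k" for k
    using street_dist_pos[OF \<open>D > 0\<close>, of k] by (simp add: \<beta>)
  have a_pos: "0 < a k" for k
    using assms(2-6) \<open>s > 0\<close> \<beta>_pos[of k] by (simp add: a_def z)
  have w_nonneg: "0 \<le> w k u" for k u
    using assms(2-6) \<open>s > 0\<close> by (simp add: w_def path_loss_def)
  have w_meas [measurable]: "w k \<in> borel_measurable borel" for k
    unfolding w_def[abs_def] path_loss_def by measurable
  have f_meas [measurable]: "f k \<in> borel_measurable borel" for k
    unfolding f_def[abs_def] by measurable
  have [measurable]: "x k i \<in> borel_measurable M" for k i
    using measurable_compose[OF indep_var_rv2[OF marks_indep_points] measurable_component_singleton[of "(k, i)"]]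
    by simp
  have "?E \<in> sets borel" by measurable
  note functional = laplace_functional_independent_poisson[OF less_imp_le[OF \<open>\<rho> > 0\<close>] this
      poisson indep_processes f_meas]

  \<comment> \<open>The double series over streets and points is flattened to a single one along
    \<open>prod_decode\<close>, an enumeration of all pairs, to suit the lemma on marks.\<close>
  have "ennreal s * interference P\<^sub>t C \<alpha> D x h \<omega>
      = (\<Sum>n. case prod_decode n of (k, i) \<Rightarrow> ennreal (w k (x k i \<omega>) * h k i \<omega>))" for \<omega>
  proof -
    have "ennreal s * interference P\<^sub>t C \<alpha> D x h \<omega> = (\<Sum>k. \<Sum>i. ennreal (w k (x k i \<omega>) * h k i \<omega>))"
      unfolding interference_def using \<open>s > 0\<close>
      by (simp add: ennreal_suminf_cmult[symmetric] ennreal_mult'[symmetric] w_def mult_ac)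
    then show ?thesis
      using suminf_ennreal_2dimen[of "\<lambda>k. \<Sum>i. ennreal (w k (x k i \<omega>) * h k i \<omega>)"
          "\<lambda>(k, i). ennreal (w k (x k i \<omega>) * h k i \<omega>)"]
      by simp
  qed
  then have "laplace_transform M (interference P\<^sub>t C \<alpha> D x h) s
      = expectation (\<lambda>\<omega>. exp_neg (\<Sum>n. case prod_decode n of (k, i) \<Rightarrow> ennreal (w k (x k i \<omega>) * h k i \<omega>)))"
    by (simp add: laplace_transform_def)
  also have "\<dots> = expectation (\<lambda>\<omega>. exp_neg (\<Sum>n. case prod_decode n of (k, i) \<Rightarrow> f k (x k i \<omega>)))"
  proof -
    have "expectation (\<lambda>\<omega>. exp_neg (\<Sum>n. ennreal (w (fst (prod_decode n)) (x (fst (prod_decode n)) (snd (prod_decode n)) \<omega>)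
          * h (fst (prod_decode n)) (snd (prod_decode n)) \<omega>)))
        = expectation (\<lambda>\<omega>. exp_neg (\<Sum>n. ennreal (ln (1 + w (fst (prod_decode n))
            (x (fst (prod_decode n)) (snd (prod_decode n)) \<omega>)))))"
    proof (rule laplace_exponential_marks[where H = "\<lambda>p. h (fst p) (snd p)" and X = "\<lambda>p. x (fst p) (snd p)"
          and c = "\<lambda>p. w (fst p)" and e = prod_decode])
      show "inj prod_decode" by (rule inj_prod_decode)
      show "indep_vars (\<lambda>_. borel) (\<lambda>p. h (fst p) (snd p)) UNIV"
        using marks_indep by (simp only: case_prod_unfold)
      show "indep_var (PiM UNIV (\<lambda>_. borel)) (\<lambda>\<omega> p. h (fst p) (snd p) \<omega>)
          (PiM UNIV (\<lambda>_. borel)) (\<lambda>\<omega> p. x (fst p) (snd p) \<omega>)"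
        using marks_indep_points by (simp only: case_prod_unfold)
    qed (rule marks_exp w_meas w_nonneg)+
    then show ?thesis by (simp only: case_prod_unfold f_def)
  qed
  \<comment> \<open>Almost surely the \<open>x k i\<close> run through the points of street k
    exactly once, so the series over i is the sum over the point set. As this holds only almost
    everywhere, measurability of both sides has to be supplied.\<close>
  also have "\<dots> = expectation (\<lambda>\<omega>. exp_neg (\<Sum>k. \<integral>\<^sup>+u. f k u \<partial>count_space (\<Phi> k \<omega>)))"
  proof (rule integral_cong_AE)
    show "(\<lambda>\<omega>. exp_neg (\<Sum>n. case prod_decode n of (k, i) \<Rightarrow> f k (x k i \<omega>))) \<in> borel_measurable M"
      unfolding case_prod_unfold by measurable
    show "(\<lambda>\<omega>. exp_neg (\<Sum>k. \<integral>\<^sup>+u. f k u \<partial>count_space (\<Phi> k \<omega>))) \<in> borel_measurable M"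
      by (rule measurable_compose[OF functional(1) borel_measurable_exp_neg])
    show "AE \<omega> in M. exp_neg (\<Sum>n. case prod_decode n of (k, i) \<Rightarrow> f k (x k i \<omega>))
        = exp_neg (\<Sum>k. \<integral>\<^sup>+u. f k u \<partial>count_space (\<Phi> k \<omega>))"
      using points
    proof eventually_elim
      case (elim \<omega>)
      have "(\<Sum>n. case prod_decode n of (k, i) \<Rightarrow> f k (x k i \<omega>)) = (\<Sum>k. \<Sum>i. f k (x k i \<omega>))"
        by (rule suminf_ennreal_2dimen) simp
      also have "\<dots> = (\<Sum>k. \<integral>\<^sup>+u. f k u \<partial>count_space (\<Phi> k \<omega>))"
        using nn_integral_bij_count_space[of "\<lambda>i. x k i \<omega>" UNIV "\<Phi> k \<omega>" "f k" for k] elim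
        by (simp add: nn_integral_count_space_nat)
      finally show ?case by simp
    qed
  qed
  also have "\<dots> = exp_neg (ennreal \<rho> * (\<Sum>k. \<integral>\<^sup>+u\<in>?E. ennreal (1 - exp_neg (f k u)) \<partial>lborel))"
    by (rule functional(2))
  also have "(\<lambda>k. \<integral>\<^sup>+u\<in>?E. ennreal (1 - exp_neg (f k u)) \<partial>lborel)
      = (\<lambda>k. 2 * ennreal (sqrt (a k) * arctan (sqrt (a k))))"
  proof
    fix k
    have "(\<integral>\<^sup>+u\<in>?E. ennreal (1 - exp_neg (f k u)) \<partial>lborel)
        = (\<integral>\<^sup>+u\<in>?E. ennreal (a k / (a k + u\<^sup>2)) \<partial>lborel)"
    proof (intro nn_integral_cong)
      fix u
      show "ennreal (1 - exp_neg (f k u)) * indicator ?E u = ennreal (a k / (a k + u\<^sup>2)) * indicator ?E u"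
      proof (cases "u \<in> ?E")
        case True
        then have "u \<noteq> 0" by auto
        \<comment> \<open>Away from 0 the power |u| powr (-2) is 1 / u^2, and the distance factor is
          1 / \<beta>. On |u| < 1 the indicator removes both integrands.\<close>
        then have "w k u = a k / u\<^sup>2"
          by (simp add: w_def path_loss_def a_def z \<beta> powr_minus powr_numeral divide_simps)
        moreover have "1 - exp_neg (f k u) = w k u / (1 + w k u)"
          using w_nonneg[of k u]
          by (simp add: f_def exp_neg_ennreal exp_minus field_simps)
        moreover have "a k / u\<^sup>2 / (1 + a k / u\<^sup>2) = a k / (a k + u\<^sup>2)"
          using \<open>u \<noteq> 0\<close> a_pos[of k] by (simp add: add_divide_distrib[symmetric] divide_simps add.commute)
        ultimately have "1 - exp_neg (f k u) = a k / (a k + u\<^sup>2)"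
          by (simp only:)
        then show ?thesis by (simp only:)
      qed simp
    qed
    then show "(\<integral>\<^sup>+u\<in>?E. ennreal (1 - exp_neg (f k u)) \<partial>lborel) = 2 * ennreal (sqrt (a k) * arctan (sqrt (a k)))"
      by (simp only: nn_integral_rational_outside_unit_interval[OF a_pos])
  qed
  also have "ennreal \<rho> * (\<Sum>k. 2 * ennreal (sqrt (a k) * arctan (sqrt (a k))))
      = ennreal (2 * \<rho>) * (\<Sum>k. ennreal (sqrt (a k) * arctan (sqrt (a k))))"
    using ennreal_mult'[of 2 \<rho>] by (simp add: ennreal_suminf_cmult mult_ac)
  finally show ?thesis by (simp add: a_def)
qed

end
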